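(* For finite graphs (loops and multiple edges allowed): (a) For any graphs $G_1,G_2$ with disjoint union $G_1\cup G_2$, $\theta_{G_1\cup G_2}(\beta,\gamma)=\theta_{G_1}(\beta,\gamma)\,\theta_{G_2}(\beta,\gamma)$. (b) For every $n\ge 0$, $\theta_{B_n}(\beta,\gamma)=\sum_{k=0}^{n}\binom{n}{k}f_{2k}(\gamma)\beta^{k}$, where $B_n$ is the graph with a single vertex and $n$ loops. (c) For every graph $G$, $\theta_G(\beta,\gamma)=\theta_{\mathrm{core}(G)}(\beta,\gamma)$.
   Context: Graphs are finite undirected multigraphs; loops and multiple edges are allowed. The degree of a vertex is the number of edge-ends at it (a loop counts twice). A subset $s\subset E$ is identified with the spanning subgraph $(V,s)$, and $d_i(s)$ is the degree of vertex $i$ in $(V,s)$. The core $\mathrm{core}(G)$ of $G$ is the graph obtained by repeatedly removing a vertex of degree one (together with its incident edge) until no vertex of degree one remains; e.g. the core of a tree is a single vertex without edges. The polynomials $f_n(x)$, $n\ge 0$, are defined by $f_0(x)=1$, $f_1(x)=0$, $f_{n+1}(x)=x f_n(x)+f_{n-1}(x)$ for $n\ge1$. The graph polynomial $\theta_G$ of $G=(V,E)$ is $$\theta_G(\beta,\gamma):=\sum_{s\subset E}\beta^{|s|}\prod_{i\in V}f_{d_i(s)}(\gamma)\in\mathbb{Z}[\beta,\gamma].$$ *)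

theory Defs
  imports "HOL-Computational_Algebra.Polynomial" "HOL-Library.Multiset"
begin

text \<open>The ends of an edge form a multiset of size two, so that a loop at \<open>v\<close> has ends
  \<open>{#v, v#}\<close>. The values of \<open>ends\<close> outside \<open>edges\<close> are irrelevant.\<close>

record ('v, 'e) multigraph =
  verts :: "'v set"
  edges :: "'e set"
  ends :: "'e \<Rightarrow> 'v multiset"

locale finite_multigraph =
  fixes G :: "('v, 'e) multigraph"
  assumes finite_verts: "finite (verts G)"
    and finite_edges: "finite (edges G)"
    and size_ends: "e \<in> edges G \<Longrightarrow> size (ends G e) = 2"
    and ends_in_verts: "e \<in> edges G \<Longrightarrow> set_mset (ends G e) \<subseteq> verts G"

definition vdegree :: "('v, 'e) multigraph \<Rightarrow> 'e set \<Rightarrow> 'v \<Rightarrow> nat" where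
  "vdegree G s v = (\<Sum>e\<in>s. count (ends G e) v)"

definition disjoint_union ::
  "('v, 'e) multigraph \<Rightarrow> ('w, 'f) multigraph \<Rightarrow> ('v + 'w, 'e + 'f) multigraph" where
  "disjoint_union G H =
     \<lparr> verts = verts G <+> verts H,
       edges = edges G <+> edges H,
       ends = case_sum (\<lambda>e. image_mset Inl (ends G e)) (\<lambda>e. image_mset Inr (ends H e)) \<rparr>"

definition bouquet :: "nat \<Rightarrow> (unit, nat) multigraph" where
  "bouquet n = \<lparr> verts = {()}, edges = {..<n}, ends = (\<lambda>_. {#(), ()#}) \<rparr>"

definition remove_vertex :: "('v, 'e) multigraph \<Rightarrow> 'v \<Rightarrow> ('v, 'e) multigraph" where
  "remove_vertex G v =
     G\<lparr> verts := verts G - {v}, edges := {e \<in> edges G. v \<notin># ends G e} \<rparr>"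

inductive leaf_removal :: "('v, 'e) multigraph \<Rightarrow> ('v, 'e) multigraph \<Rightarrow> bool" where
  "v \<in> verts G \<Longrightarrow> vdegree G (edges G) v = 1 \<Longrightarrow> leaf_removal G (remove_vertex G v)"

text \<open>The core is determined only up to isomorphism (the core of a single non-loop edge may be
  either of its ends), hence it is a relation rather than a function. Every finite multigraph
  has a core, see \<open>core_exists\<close> below.\<close>

definition is_core :: "('v, 'e) multigraph \<Rightarrow> ('v, 'e) multigraph \<Rightarrow> bool" where
  "is_core G H \<longleftrightarrow> leaf_removal\<^sup>*\<^sup>* G H \<and> (\<forall>v\<in>verts H. vdegree H (edges H) v \<noteq> 1)"

fun fpoly :: "nat \<Rightarrow> int poly" where
  "fpoly 0 = 1"
| "fpoly (Suc 0) = 0"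
| "fpoly (Suc (Suc n)) = [:0, 1:] * fpoly (Suc n) + fpoly n"

text \<open>The ring of integer polynomials in \<open>\<beta>, \<gamma>\<close> is represented by \<^typ>\<open>int poly poly\<close>: the
  outer variable is \<open>\<beta>\<close> and the coefficients are polynomials in \<open>\<gamma>\<close>.\<close>

definition theta :: "('v, 'e) multigraph \<Rightarrow> int poly poly" where
  "theta G = (\<Sum>s\<in>Pow (edges G). monom (\<Prod>i\<in>verts G. fpoly (vdegree G s i)) (card s))"

lemma finite_multigraph_disjoint_union:
  assumes "finite_multigraph G" "finite_multigraph H"
  shows "finite_multigraph (disjoint_union G H)"
proof -
  interpret G: finite_multigraph G by fact
  interpret H: finite_multigraph H by fact
  show ?thesis
  proof
    fix e assume "e \<in> edges (disjoint_union G H)"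
    then show "size (ends (disjoint_union G H) e) = 2"
      and "set_mset (ends (disjoint_union G H) e) \<subseteq> verts (disjoint_union G H)"
      by (auto simp: disjoint_union_def G.size_ends H.size_ends
          dest: subsetD[OF G.ends_in_verts] subsetD[OF H.ends_in_verts])
  qed (simp_all add: disjoint_union_def G.finite_verts H.finite_verts G.finite_edges H.finite_edges)
qed

lemma finite_multigraph_bouquet: "finite_multigraph (bouquet n)"
  by (simp add: finite_multigraph_def bouquet_def)

lemma finite_multigraph_remove_vertex:
  assumes "finite_multigraph G"
  shows "finite_multigraph (remove_vertex G v)"
  using assms by (auto simp: finite_multigraph_def remove_vertex_def)

lemma core_exists:
  assumes "finite_multigraph G"
  shows "\<exists>H. is_core G H"
  using assms
proof (induction "card (verts G)" arbitrary: G rule: less_induct)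
  case less
  show ?case
  proof (cases "\<exists>v\<in>verts G. vdegree G (edges G) v = 1")
    case True
    then obtain v where v: "v \<in> verts G" "vdegree G (edges G) v = 1" by blast
    have "card (verts (remove_vertex G v)) < card (verts G)"
      using card_Diff1_less[OF finite_multigraph.finite_verts[OF less.prems] v(1)]
      by (simp add: remove_vertex_def)
    then obtain H where "is_core (remove_vertex G v) H"
      using less.hyps[OF _ finite_multigraph_remove_vertex[OF less.prems]] by blast
    then have "is_core G H"
      using converse_rtranclp_into_rtranclp[of leaf_removal, OF leaf_removal.intros[OF v]]
      by (simp add: is_core_def)
    then show ?thesis ..
  next
    case False
    then have "is_core G G" by (simp add: is_core_def)
    then show ?thesis ..
  qed
qed

end

theory Submission
  imports Defs
begin

text \<open>
  All three identities are reorganisations of the state sum over edge subsets.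

  For a disjoint union, an edge subset is a pair of edge subsets of the two parts, and both the
  degrees and the number of edges split accordingly, so the double sum factors.

  For a bouquet, the only vertex has degree \<open>2 * card s\<close> in the subset \<open>s\<close>, so that the sum can
  be grouped by \<open>card s\<close>, each size \<open>k\<close> occurring \<open>n choose k\<close> times.

  For the core, the point is that \<open>f\<^sub>1 = 0\<close> and \<open>f\<^sub>0 = 1\<close>. If \<open>v\<close> has degree one in the
  graph, every subset that contains the edge at \<open>v\<close> has the factor \<open>f\<^sub>1 = 0\<close> and contributes
  nothing, while in every other subset \<open>v\<close> contributes the factor \<open>f\<^sub>0 = 1\<close>. What remains is the
  state sum of the graph without \<open>v\<close> (lemma \<open>theta_remove_leaf\<close>), and the core is reached by
  finitely many such steps.
\<close>

lemma bij_betw_Plus_Pow: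
  "bij_betw (\<lambda>(s, t). s <+> t) (Pow A \<times> Pow B) (Pow (A <+> B))"
  by (rule bij_betw_byWitness[where f' = "\<lambda>u. (Inl -` u, Inr -` u)"]) auto

lemma count_image_mset_inj:
  assumes "inj f"
  shows "count (image_mset f M) (f x) = count M x"
  by (induction M) (simp_all add: inj_eq[OF assms])

lemma vdegree_disjoint_union:
  assumes "finite s" "finite t"
  shows "vdegree (disjoint_union G H) (s <+> t) (Inl v) = vdegree G s v"
    and "vdegree (disjoint_union G H) (s <+> t) (Inr w) = vdegree H t w"
  using assms
  by (auto simp: vdegree_def disjoint_union_def sum.Plus count_image_mset_inj count_eq_zero_iff)

lemma theta_disjoint_union:
  assumes "finite_multigraph G" "finite_multigraph H"
  shows "theta (disjoint_union G H) = theta G * theta H"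
proof -
  interpret G: finite_multigraph G by fact
  interpret H: finite_multigraph H by fact
  let ?U = "disjoint_union G H"
  let ?term = "\<lambda>K s. monom (\<Prod>i\<in>verts K. fpoly (vdegree K s i)) (card s)"
  have split: "?term ?U (s <+> t) = ?term G s * ?term H t"
    if "s \<subseteq> edges G" "t \<subseteq> edges H" for s t
  proof -
    have fin: "finite s" "finite t"
      using that G.finite_edges H.finite_edges finite_subset by blast+
    have "verts ?U = verts G <+> verts H"
      by (simp add: disjoint_union_def)
    then show ?thesis
      by (simp add: mult_monom prod.Plus G.finite_verts H.finite_verts fin
          vdegree_disjoint_union card_Plus)
  qed
  have "theta ?U = (\<Sum>u\<in>Pow (edges G <+> edges H). ?term ?U u)"
    by (simp add: theta_def disjoint_union_def)
  also have "\<dots> = (\<Sum>(s, t)\<in>Pow (edges G) \<times> Pow (edges H). ?term ?U (s <+> t))"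
    by (subst sum.reindex_bij_betw[OF bij_betw_Plus_Pow, symmetric])
      (simp add: case_prod_beta)
  also have "\<dots> = (\<Sum>(s, t)\<in>Pow (edges G) \<times> Pow (edges H). ?term G s * ?term H t)"
    by (rule sum.cong) (auto simp: split)
  also have "\<dots> = theta G * theta H"
    by (simp add: theta_def sum_product sum.cartesian_product)
  finally show ?thesis .
qed

lemma theta_bouquet:
  "theta (bouquet n) = (\<Sum>k = 0..n. monom (of_nat (n choose k) * fpoly (2 * k)) k)"
proof -
  have "theta (bouquet n) = (\<Sum>s\<in>Pow {..<n}. monom (fpoly (2 * card s)) (card s))"
    by (simp add: theta_def bouquet_def vdegree_def mult_2 mult_2_right)
  also have "\<dots> = (\<Sum>k = 0..n. \<Sum>s\<in>{s \<in> Pow {..<n}. card s = k}.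
      monom (fpoly (2 * card s)) (card s))"
    using card_mono[OF finite_lessThan, of _ n] by (intro sum.group[symmetric]) auto
  also have "\<dots> = (\<Sum>k = 0..n. of_nat (n choose k) * monom (fpoly (2 * k)) k)"
    by (rule sum.cong) (simp_all add: n_subsets[of "{..<n}", simplified])
  also have "\<dots> = (\<Sum>k = 0..n. monom (of_nat (n choose k) * fpoly (2 * k)) k)"
    by (simp add: of_nat_poly smult_monom)
  finally show ?thesis .
qed

text \<open>Because \<open>f\<^sub>1 = 0\<close>, the state sum is supported on the subsets that avoid the edge at \<open>v\<close>;
  these are exactly the edge subsets of the graph without \<open>v\<close>, and on them \<open>v\<close> contributes
  \<open>f\<^sub>0 = 1\<close>.\<close>

lemma theta_remove_leaf:
  assumes fin: "finite (verts G)" "finite (edges G)"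
    and v: "v \<in> verts G" "vdegree G (edges G) v = 1"
  shows "theta (remove_vertex G v) = theta G"
proof -
  let ?F = "{e \<in> edges G. v \<notin># ends G e}"
  let ?term = "\<lambda>V s. monom (\<Prod>i\<in>V. fpoly (vdegree G s i)) (card s)"
  \<comment> \<open>Degrees are monotone in the subset, so a subset with an edge at \<open>v\<close> already attains the
    full degree one.\<close>
  have deg_1: "vdegree G s v = 1" if "s \<subseteq> edges G" "\<not> s \<subseteq> ?F" for s
  proof -
    have "vdegree G s v \<le> 1"
      using v(2) sum_mono2[OF fin(2) that(1)] by (metis vdegree_def zero_le)
    moreover have "vdegree G s v \<noteq> 0"
      using that finite_subset[OF that(1) fin(2)] by (auto simp: vdegree_def)
    ultimately show ?thesis by simp
  qed
  have vanish: "?term (verts G) s = 0" if "s \<subseteq> edges G" "\<not> s \<subseteq> ?F" for s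
  proof -
    have "fpoly (vdegree G s v) = 0"
      by (simp add: deg_1[OF that])
    then show ?thesis
      using prod_zero[OF fin(1) bexI[OF _ v(1)], of "\<lambda>i. fpoly (vdegree G s i)"] by simp
  qed
  have deg_0: "vdegree G s v = 0" if "s \<subseteq> ?F" for s
    using that by (auto simp: vdegree_def count_eq_zero_iff intro!: sum.neutral)
  have "theta (remove_vertex G v) = (\<Sum>s\<in>Pow ?F. ?term (verts G - {v}) s)"
    by (simp add: theta_def remove_vertex_def vdegree_def)
  also have "\<dots> = (\<Sum>s\<in>Pow ?F. ?term (verts G) s)"
    by (rule sum.cong) (auto simp: prod.remove[OF fin(1) v(1)] deg_0)
  also have "\<dots> = (\<Sum>s\<in>Pow (edges G). ?term (verts G) s)"
    using fin(2) by (intro sum.mono_neutral_left ballI vanish) auto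
  finally show ?thesis
    by (simp add: theta_def)
qed

lemma theta_leaf_removals:
  assumes "leaf_removal\<^sup>*\<^sup>* G H" "finite_multigraph G"
  shows "theta G = theta H"
  using assms
proof (induction rule: converse_rtranclp_induct)
  case base
  show ?case ..
next
  case (step G K)
  from step.hyps(1) have "finite_multigraph K \<and> theta K = theta G"
    by cases (use step.prems in \<open>auto simp: finite_multigraph_remove_vertex
      finite_multigraph.finite_verts finite_multigraph.finite_edges theta_remove_leaf\<close>)
  with step.IH show ?case by simp
qed

theorem proposition1:
  fixes G\<^sub>1 :: "('v1, 'e1) multigraph"
    and G\<^sub>2 :: "('v2, 'e2) multigraph"
    and G H :: "('v, 'e) multigraph"
    and n :: nat
  shows "(finite_multigraph G\<^sub>1 \<and> finite_multigraph G\<^sub>2 \<longrightarrow>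
            theta (disjoint_union G\<^sub>1 G\<^sub>2) = theta G\<^sub>1 * theta G\<^sub>2)
       \<and> theta (bouquet n) = (\<Sum>k = 0..n. monom (of_nat (n choose k) * fpoly (2 * k)) k)
       \<and> (finite_multigraph G \<and> is_core G H \<longrightarrow> theta G = theta H)"
  using theta_disjoint_union theta_bouquet theta_leaf_removals
  by (auto simp: is_core_def)

end
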